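(* Let $c>0$ and let $h:[0,c]\to\mathbb{R}$ be a continuous and strictly increasing function with $h(0)=0$, and let $h^{-1}:[0,h(c)]\to[0,c]$ be the inverse function of $h$. Let $a\in[0,c]$ and $b\in[0,h(c)]$, and put $\alpha=\min\{a,h^{-1}(b)\}$ and $\beta=\max\{a,h^{-1}(b)\}$. Let $L<U$ be real constants, and suppose that $h$ is differentiable on $(\alpha,\beta)$ with $L\le h'(x)\le U$ for all $x\in(\alpha,\beta)$. Then $$\frac{LU\bigl[a-h^{-1}(b)\bigr]^2-2\bigl[a-h^{-1}(b)\bigr]\bigl[Lh(a)-Ub\bigr]+[h(a)-b]^2}{2(U-L)}\le\int_0^a h(x)\,dx+\int_0^b h^{-1}(x)\,dx-b\,h^{-1}(b)$$ and $$\int_0^a h(x)\,dx+\int_0^b h^{-1}(x)\,dx-b\,h^{-1}(b)\le-\frac{LU\bigl[a-h^{-1}(b)\bigr]^2-2\bigl[a-h^{-1}(b)\bigr]\bigl[Uh(a)-Lb\bigr]+[h(a)-b]^2}{2(U-L)}.$$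
   Context: No assumption is made on which of $a$ and $h^{-1}(b)$ is larger; if $a=h^{-1}(b)$, the interval $(\alpha,\beta)$ is empty and the derivative condition is vacuous. *)

theory Defs
  imports "HOL-Analysis.Analysis"
begin

end

theory Submission
  imports Defs
begin

text \<open>
  Write \<open>p\<close> for the point \<open>hinv b\<close>, so that \<open>h p = b\<close>. The equality case of Young's inequality,
  \<open>integral_plus_integral_inverse\<close>, says that the region below the graph of \<open>h\<close> over \<open>[0, p]\<close> and
  the region to the left of the graph up to height \<open>b\<close> together fill the rectangle with sides
  \<open>p\<close> and \<open>b\<close>. Hence the quantity to be estimated is the oriented integral of \<open>h\<close>
  from \<open>p\<close> to \<open>a\<close>, and the inverse function disappears from the problem.

  On the interval between \<open>p\<close> and \<open>a\<close> the end values of \<open>h\<close> are known and its slope lies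
  between \<open>L\<close> and \<open>U\<close>. Such a function stays inside the parallelogram that is cut out by the lines
  of slope \<open>L\<close> and \<open>U\<close> through the two end points of its graph, so its integral lies
  between the integrals of the lower and the upper boundary of this parallelogram
  (an inequality of Iyengar type: \<open>integral_ge_slopes\<close> and \<open>integral_le_slopes\<close>).

  If \<open>a < p\<close>, the orientation changes the sign of the integral and thereby exchanges the upper and
  the lower bound. Exchanging the end points in the two bounds has exactly the same effect, and so
  one pair of formulas serves both positions of \<open>a\<close>.
\<close>

section \<open>Integrals of functions with bounded slope\<close>

text \<open>
  By the mean value theorem, \<open>f\<close> lies above the line of slope \<open>L\<close> through its left end point
  and above the line of slope \<open>U\<close> through its right end point. The bound is the integral of
  the maximum of these two lines.
\<close>

lemma integral_ge_slopes:
  fixes f f' :: "real \<Rightarrow> real"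
  assumes pq: "p \<le> q" and LU: "L < U"
    and cont: "continuous_on {p..q} f"
    and der: "\<And>x. p < x \<Longrightarrow> x < q \<Longrightarrow> (f has_real_derivative f' x) (at x)"
    and slope: "\<And>x. p < x \<Longrightarrow> x < q \<Longrightarrow> L \<le> f' x \<and> f' x \<le> U"
  shows "(L * U * (q - p)\<^sup>2 - 2 * (q - p) * (L * f q - U * f p) + (f q - f p)\<^sup>2) / (2 * (U - L))
    \<le> integral {p..q} f"
proof -
  have incr: "L * (y - x) \<le> f y - f x \<and> f y - f x \<le> U * (y - x)"
    if "p \<le> x" "x \<le> y" "y \<le> q" for x y
  proof (cases "x = y")
    case False
    then have "x < y" using that by simp
    moreover have "continuous_on {x..y} f"
      using cont continuous_on_subset that by (metis atLeastatMost_subset_iff)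
    moreover have "(f has_derivative (*) (f' z)) (at z)" if "x < z" "z < y" for z
      using der[of z] that \<open>p \<le> x\<close> \<open>y \<le> q\<close> by (simp add: has_field_derivative_def)
    ultimately obtain z where z: "x < z" "z < y" "f y - f x = f' z * (y - x)"
      by (rule mvt[of x y f "\<lambda>z. (*) (f' z)"])
    have "L \<le> f' z" "f' z \<le> U" using slope[of z] z that by auto
    then show ?thesis
      using \<open>x < y\<close> by (simp add: z(3) mult_right_mono)
  qed simp
  \<comment> \<open>The two lines meet at \<open>m = p + t\<close>; the slope bounds for the chord place \<open>m\<close> in \<open>[p, q]\<close>.\<close>
  define t where "t = (U * (q - p) - (f q - f p)) / (U - L)"
  define m where "m = p + t"
  have "0 \<le> t" using incr[of p q] pq LU by (simp add: t_def)
  have q_m: "q - m = ((f q - f p) - L * (q - p)) / (U - L)"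
    using LU by (simp add: m_def t_def field_simps)
  have "m \<le> q"
  proof -
    have "0 \<le> q - m" unfolding q_m using incr[of p q] pq LU by simp
    then show ?thesis by simp
  qed
  have "p \<le> m" using \<open>0 \<le> t\<close> by (simp add: m_def)
  note int = integrable_continuous_real[OF continuous_on_subset[OF cont]]
  have left: "((\<lambda>x. f p + L * (x - p)) has_integral f p * (m - p) + L * (m - p)\<^sup>2 / 2) {p..m}"
  proof -
    have "((\<lambda>x. f p + L * (x - p)) has_integral
        (f p * m + L * (m - p)\<^sup>2 / 2) - (f p * p + L * (p - p)\<^sup>2 / 2)) {p..m}"
      by (rule fundamental_theorem_of_calculus[OF \<open>p \<le> m\<close>])
        (auto simp flip: has_real_derivative_iff_has_vector_derivative intro!: derivative_eq_intros)
    then show ?thesis by (simp add: algebra_simps)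
  qed
  have right: "((\<lambda>x. f q - U * (q - x)) has_integral f q * (q - m) - U * (q - m)\<^sup>2 / 2) {m..q}"
  proof -
    have "((\<lambda>x. f q - U * (q - x)) has_integral
        (f q * q + U * (q - q)\<^sup>2 / 2) - (f q * m + U * (q - m)\<^sup>2 / 2)) {m..q}"
      by (rule fundamental_theorem_of_calculus[OF \<open>m \<le> q\<close>])
        (auto simp flip: has_real_derivative_iff_has_vector_derivative intro!: derivative_eq_intros simp: field_simps)
    then show ?thesis by (simp add: algebra_simps)
  qed
  have above_left: "f p + L * (x - p) \<le> f x" if "x \<in> {p..m}" for x
    using incr[of p x] that \<open>m \<le> q\<close> by simp
  have above_right: "f q - U * (q - x) \<le> f x" if "x \<in> {m..q}" for x
    using incr[of x q] that \<open>p \<le> m\<close> by simp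
  have "f p * (m - p) + L * (m - p)\<^sup>2 / 2 \<le> integral {p..m} f"
    by (rule has_integral_le[OF left integrable_integral[OF int] above_left])
      (use \<open>m \<le> q\<close> in auto)
  moreover have "f q * (q - m) - U * (q - m)\<^sup>2 / 2 \<le> integral {m..q} f"
    by (rule has_integral_le[OF right integrable_integral[OF int] above_right])
      (use \<open>p \<le> m\<close> in auto)
  moreover have "integral {p..m} f + integral {m..q} f = integral {p..q} f"
    using \<open>p \<le> m\<close> \<open>m \<le> q\<close> int[of p q] by (intro Henstock_Kurzweil_Integration.integral_combine) auto
  moreover have "f p * (m - p) + L * (m - p)\<^sup>2 / 2 + (f q * (q - m) - U * (q - m)\<^sup>2 / 2)
    = (L * U * (q - p)\<^sup>2 - 2 * (q - p) * (L * f q - U * f p) + (f q - f p)\<^sup>2) / (2 * (U - L))"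
  proof -
    \<comment> \<open>Along the two lines the function first rises by \<open>L * u\<close> and then by \<open>U * v\<close>; in the widths
      \<open>u, v\<close> of the two pieces the claim is a polynomial identity.\<close>
    have alg: "B * u + L * u\<^sup>2 / 2 + (A * v - U * v\<^sup>2 / 2)
      = (L * U * d\<^sup>2 - 2 * d * (L * A - U * B) + (A - B)\<^sup>2) / (2 * (U - L))"
      if "d = u + v" "A = B + L * u + U * v" for A B d u v
      unfolding that using LU
      by (simp add: nonzero_eq_divide_eq) (simp add: power2_eq_square field_simps)
    have "(q - m) * (U - L) = (f q - f p) - L * (q - p)"
      unfolding q_m using LU by simp
    then have "f q = f p + L * (m - p) + U * (q - m)"
      by (simp add: algebra_simps)
    then show ?thesis by (intro alg) simp_all
  qed
  ultimately show ?thesis by linarith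
qed

text \<open>
  The reflection \<open>f \<mapsto> - f\<close> turns the slope bounds \<open>L, U\<close> into \<open>- U, - L\<close> and the lower bound
  into an upper bound.
\<close>
lemma integral_le_slopes:
  fixes f f' :: "real \<Rightarrow> real"
  assumes pq: "p \<le> q" and LU: "L < U"
    and cont: "continuous_on {p..q} f"
    and der: "\<And>x. p < x \<Longrightarrow> x < q \<Longrightarrow> (f has_real_derivative f' x) (at x)"
    and slope: "\<And>x. p < x \<Longrightarrow> x < q \<Longrightarrow> L \<le> f' x \<and> f' x \<le> U"
  shows "integral {p..q} f
    \<le> - ((L * U * (q - p)\<^sup>2 - 2 * (q - p) * (U * f q - L * f p) + (f q - f p)\<^sup>2) / (2 * (U - L)))"
proof -
  have "(- U * - L * (q - p)\<^sup>2 - 2 * (q - p) * (- U * - f q - - L * - f p) + (- f q - - f p)\<^sup>2)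
      / (2 * (- L - - U)) \<le> integral {p..q} (\<lambda>x. - f x)"
    by (rule integral_ge_slopes[where f' = "\<lambda>x. - f' x"])
      (use assms in \<open>auto intro!: continuous_intros derivative_intros\<close>)
  moreover have "(- f q - - f p)\<^sup>2 = (f q - f p)\<^sup>2"
    by (simp add: power2_eq_square algebra_simps)
  ultimately show ?thesis
    by (simp add: mult.commute)
qed

section \<open>The equality case of Young's inequality\<close>

lemma integral_between_bounds:
  fixes g :: "real \<Rightarrow> real"
  assumes "x \<le> y" "continuous_on {x..y} g" "\<And>z. z \<in> {x..y} \<Longrightarrow> l \<le> g z \<and> g z \<le> u"
  shows "l * (y - x) \<le> integral {x..y} g \<and> integral {x..y} g \<le> u * (y - x)"
proof -
  have int: "(g has_integral integral {x..y} g) {x..y}"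
    using assms(2) by (intro integrable_integral integrable_continuous_real)
  have const: "((\<lambda>_. k) has_integral k * (y - x)) {x..y}" for k :: real
    using has_integral_const_real[of k x y] assms(1) by (simp add: mult.commute)
  show ?thesis
    using has_integral_le[OF const int] has_integral_le[OF int const] assms(3) by blast
qed

text \<open>
  As \<open>h\<close> is merely continuous, the term \<open>p * h p\<close> cannot be differentiated on its own.
  Instead, let \<open>F\<close> be the difference of the two sides as a function of the upper limit. When the
  limit moves from \<open>x\<close> to \<open>y\<close>, both integrals change by amounts that are known up to the area of
  the small rectangle with sides \<open>y - x\<close> and \<open>h y - h x\<close>, so \<open>F\<close> changes by at most that area.
  As \<open>h\<close> is continuous, this is \<open>o(y - x)\<close>. Thus \<open>F\<close> has derivative zero everywhere, and it is
  constantly equal to its value \<open>F 0 = 0\<close>.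
\<close>
lemma integral_plus_integral_inverse:
  fixes h :: "real \<Rightarrow> real"
  assumes cont: "continuous_on {0..c} h" and mono: "strict_mono_on {0..c} h" and h0: "h 0 = 0"
    and p: "p \<in> {0..c}"
  shows "integral {0..p} h + integral {0..h p} (inv_into {0..c} h) = p * h p"
proof -
  define g where "g = inv_into {0..c} h"
  have inj: "inj_on h {0..c}" using mono by (rule strict_mono_on_imp_inj_on)
  have gh: "g (h x) = x" if "x \<in> {0..c}" for x
    using inv_into_f_f[OF inj that] by (simp add: g_def)
  have hle: "h x \<le> h y" if "0 \<le> x" "x \<le> y" "y \<le> c" for x y
    using strict_mono_on_leD[OF mono] that by simp
  have surj: "\<exists>w. x \<le> w \<and> w \<le> y \<and> h w = z"
    if "0 \<le> x" "x \<le> y" "y \<le> c" "h x \<le> z" "z \<le> h y" for x y z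
    using IVT'[of h x z y] that continuous_on_subset[OF cont, of "{x..y}"] by auto
  have "h ` {0..c} = {0..h c}"
    using hle[of 0] hle[of _ c] surj[of 0 c] p h0 by (fastforce simp: image_iff)
  then have contg: "continuous_on {0..h c} g"
    using continuous_on_inv[OF cont compact_Icc, of g] gh by auto
  define F where "F x = integral {0..x} h + integral {0..h x} g - x * h x" for x
  have step: "\<bar>F y - F x\<bar> \<le> (y - x) * (h y - h x)" if xy: "0 \<le> x" "x \<le> y" "y \<le> c" for x y
  proof -
    have hxy: "0 \<le> h x" "h x \<le> h y" "h y \<le> h c" using hle[of 0 x] hle xy h0 by auto
    have ch: "continuous_on {x..y} h" "continuous_on {0..y} h"
      using cont xy by (auto elim!: continuous_on_subset)
    have cg: "continuous_on {h x..h y} g" "continuous_on {0..h y} g"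
      using contg hxy by (auto elim!: continuous_on_subset)
    have H: "integral {0..x} h + integral {x..y} h = integral {0..y} h"
      using integrable_continuous_real[OF ch(2)] xy by (intro Henstock_Kurzweil_Integration.integral_combine) auto
    have G: "integral {0..h x} g + integral {h x..h y} g = integral {0..h y} g"
      using integrable_continuous_real[OF cg(2)] hxy by (intro Henstock_Kurzweil_Integration.integral_combine) auto
    have bh: "h x * (y - x) \<le> integral {x..y} h \<and> integral {x..y} h \<le> h y * (y - x)"
      by (rule integral_between_bounds) (use xy ch hle in auto)
    have gb: "x \<le> g z \<and> g z \<le> y" if "z \<in> {h x..h y}" for z
      using surj[OF xy, of z] gh that xy by force
    have bg: "x * (h y - h x) \<le> integral {h x..h y} g \<and> integral {h x..h y} g \<le> y * (h y - h x)"
      by (rule integral_between_bounds) (use hxy cg gb in auto)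
    have "F y - F x \<le> (y - x) * (h y - h x)"
      using H G bh bg by (simp add: F_def algebra_simps)
    moreover have "- (F y - F x) \<le> (y - x) * (h y - h x)"
      using H G bh bg by (simp add: F_def algebra_simps)
    ultimately show ?thesis by (rule abs_leI)
  qed
  have step': "norm (F y - F x) \<le> norm (h y - h x) * norm (y - x)" if "x \<in> {0..c}" "y \<in> {0..c}" for x y
  proof (cases "x \<le> y")
    case True
    then show ?thesis using step[of x y] hle[of x y] that by (simp add: mult.commute)
  next
    case False
    then show ?thesis using step[of y x] hle[of y x] that
      by (simp add: mult.commute abs_minus_commute)
  qed
  have "(F has_derivative (\<lambda>_. 0)) (at x within {0..c})" if x: "x \<in> {0..c}" for x
  proof (rule has_derivativeI_sandwich[of 1])
    show "((\<lambda>y. norm (h y - h x)) \<longlongrightarrow> 0) (at x within {0..c})"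
      using cont x by (intro tendsto_norm_zero LIM_zero) (simp add: continuous_on_def)
    show "norm (F y - F x - 0) / norm (y - x) \<le> norm (h y - h x)"
      if "y \<in> {0..c}" "y \<noteq> x" "dist y x < 1" for y
      using step'[OF x that(1)] that by (simp add: divide_le_eq)
  qed auto
  then have "F p = F 0"
    using p by (intro has_derivative_zero_unique[of "{0..c}"]) auto
  then show ?thesis by (simp add: F_def h0 g_def)
qed

section \<open>Estimates for the Young difference\<close>

theorem theorem2p1:
  fixes h hinv :: "real \<Rightarrow> real"
    and a b c L U \<alpha> \<beta> :: real
  assumes "c > 0"
    and "continuous_on {0..c} h"
    and "strict_mono_on {0..c} h"
    and "h 0 = 0"
    and "hinv = inv_into {0..c} h"
    and "a \<in> {0..c}"
    and "b \<in> {0..h c}"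
    and "\<alpha> = min a (hinv b)"
    and "\<beta> = max a (hinv b)"
    and "L < U"
    and "h differentiable_on {\<alpha><..<\<beta>}"
    and "\<forall>x\<in>{\<alpha><..<\<beta>}. L \<le> deriv h x \<and> deriv h x \<le> U"
  shows "(L * U * (a - hinv b)\<^sup>2 - 2 * (a - hinv b) * (L * h a - U * b) + (h a - b)\<^sup>2)
           / (2 * (U - L))
         \<le> integral {0..a} h + integral {0..b} hinv - b * hinv b
       \<and> integral {0..a} h + integral {0..b} hinv - b * hinv b
         \<le> - ((L * U * (a - hinv b)\<^sup>2 - 2 * (a - hinv b) * (U * h a - L * b) + (h a - b)\<^sup>2)
               / (2 * (U - L)))"
proof -
  define p where "p = hinv b"
  have "b \<in> h ` {0..c}"
    using IVT'[of h 0 b c] assms by force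
  then have p: "p \<in> {0..c}" and hp: "h p = b"
    unfolding p_def assms(5) by (rule inv_into_into, rule f_inv_into_f)
  have young: "integral {0..p} h + integral {0..b} hinv = b * p"
    using integral_plus_integral_inverse[OF assms(2-4) p] hp assms(5) by (simp add: mult.commute)
  have der: "(h has_real_derivative deriv h x) (at x)" if "\<alpha> < x" "x < \<beta>" for x
    using that assms(11) differentiable_on_eq_differentiable_at[of "{\<alpha><..<\<beta>}" h]
      DERIV_deriv_iff_real_differentiable[of h x] by auto
  have cont: "continuous_on {\<alpha>..\<beta>} h" "continuous_on {0..\<beta>} h"
    using assms(2,6) p unfolding assms(8,9) p_def[symmetric]
    by (auto elim!: continuous_on_subset)
  have "\<alpha> \<le> \<beta>" by (simp add: assms)
  have slope: "L \<le> deriv h x \<and> deriv h x \<le> U" if "\<alpha> < x" "x < \<beta>" for x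
    using assms(12) that by simp
  note lower = integral_ge_slopes[OF \<open>\<alpha> \<le> \<beta>\<close> assms(10) cont(1) der slope]
  note upper = integral_le_slopes[OF \<open>\<alpha> \<le> \<beta>\<close> assms(10) cont(1) der slope]
  have "0 \<le> \<alpha>" using assms(6,8) p by (simp add: p_def)
  then have split: "integral {0..\<alpha>} h + integral {\<alpha>..\<beta>} h = integral {0..\<beta>} h"
    using \<open>\<alpha> \<le> \<beta>\<close> integrable_continuous_real[OF cont(2)] by (intro Henstock_Kurzweil_Integration.integral_combine) auto
  show ?thesis
  proof (cases "p \<le> a")
    case True
    then have "\<alpha> = p" "\<beta> = a" using assms(8,9) by (simp_all add: p_def)
    then show ?thesis
      using lower upper split young hp unfolding p_def[symmetric] by simp
  next
    case False
    then have ab: "\<alpha> = a" "\<beta> = p" using assms(8,9) by (simp_all add: p_def)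
    \<comment> \<open>Exchanging the end points swaps the two numerators: \<open>(r, s)\<close> is \<open>(L, U)\<close> or \<open>(U, L)\<close>.\<close>
    have eq: "L * U * (p - a)\<^sup>2 - 2 * (p - a) * (s * b - r * h a) + (b - h a)\<^sup>2
      = L * U * (a - p)\<^sup>2 - 2 * (a - p) * (r * h a - s * b) + (h a - b)\<^sup>2" for r s
      by (simp add: power2_eq_square algebra_simps)
    show ?thesis
      using lower upper split young hp unfolding p_def[symmetric] ab hp eq by linarith
  qed
qed
end
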